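(* Let $W_\alpha$ be a contractive weighted shift with positive weight sequence $\alpha=(\alpha_n)_{n\ge 0}$ and moment sequence $\gamma=(\gamma_n)_{n\ge 0}$. Then the sequence of weights squared $(\alpha_n^2)_{n\ge 0}$ (equivalently, the sequence of weights $(\alpha_n)_{n\ge0}$) is log completely alternating if and only if $\gamma$ is log completely monotone.
   Context: For a bounded sequence $\alpha=(\alpha_n)_{n\ge 0}$ of positive numbers, the weighted shift $W_\alpha$ on $\ell^2(\mathbb{N}_0)$ (canonical basis $e_0,e_1,\dots$) is the bounded linear operator with $W_\alpha e_n=\alpha_n e_{n+1}$. It is contractive if $\|W_\alpha\|=\sup_n\alpha_n\le 1$. Its moments are $\gamma_0=1$ and $\gamma_n=\prod_{j=0}^{n-1}\alpha_j^2$ for $n\ge 1$. For a sequence $a=(a_j)_{j\ge0}$ of real numbers, $(\nabla^n a)_k=\sum_{i=0}^n(-1)^i\binom{n}{i}a_{k+i}$. The sequence $a$ is completely monotone if $(\nabla^n a)_k\ge 0$ for all $n\ge 1,k\ge 0$, and completely alternating if $(\nabla^n a)_k\le 0$ for all $n\ge 1$, $k\ge 0$. A sequence of positive numbers $a$ is log completely monotone (resp. log completely alternating) if $(\ln a_j)_{j\ge0}$ is completely monotone (resp. completely alternating). *)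

theory Defs
  imports "HOL-Analysis.Analysis"
begin

text \<open>The complex Hilbert space of square-summable sequences indexed by the natural numbers,
  as a carrier set with its norm. On sequences outside the carrier the norm is meaningless.\<close>

definition l2 :: "(nat \<Rightarrow> complex) set" where
  "l2 = {x. summable (\<lambda>n. (cmod (x n))\<^sup>2)}"

definition l2_norm :: "(nat \<Rightarrow> complex) \<Rightarrow> real" where
  "l2_norm x = sqrt (\<Sum>n. (cmod (x n))\<^sup>2)"

definition l2_basis :: "nat \<Rightarrow> nat \<Rightarrow> complex" where
  "l2_basis n = (\<lambda>k. if k = n then 1 else 0)"

text \<open>The supremum is only meaningful for a bounded operator mapping \<open>l2\<close> to itself;
  for weighted shifts see \<open>weighted_shift_l2\<close> and \<open>weighted_shift_le\<close> below.\<close>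

definition l2_opnorm :: "((nat \<Rightarrow> complex) \<Rightarrow> (nat \<Rightarrow> complex)) \<Rightarrow> real" where
  "l2_opnorm T = (SUP x\<in>{x \<in> l2. l2_norm x \<le> 1}. l2_norm (T x))"

definition weighted_shift :: "(nat \<Rightarrow> real) \<Rightarrow> (nat \<Rightarrow> complex) \<Rightarrow> (nat \<Rightarrow> complex)" where
  "weighted_shift \<alpha> x = (\<lambda>n. case n of 0 \<Rightarrow> 0 | Suc m \<Rightarrow> of_real (\<alpha> m) * x m)"

definition contractive :: "((nat \<Rightarrow> complex) \<Rightarrow> (nat \<Rightarrow> complex)) \<Rightarrow> bool" where
  "contractive T \<longleftrightarrow> l2_opnorm T \<le> 1"

definition moment :: "(nat \<Rightarrow> real) \<Rightarrow> nat \<Rightarrow> real" where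
  "moment \<alpha> n = (\<Prod>j<n. (\<alpha> j)\<^sup>2)"

definition nabla :: "nat \<Rightarrow> (nat \<Rightarrow> real) \<Rightarrow> nat \<Rightarrow> real" where
  "nabla n a k = (\<Sum>i\<le>n. (-1) ^ i * real (n choose i) * a (k + i))"

text \<open>In both notions the order of the difference starts at 1, so the sign of the sequence
  itself is unrestricted.\<close>

definition completely_monotone :: "(nat \<Rightarrow> real) \<Rightarrow> bool" where
  "completely_monotone a \<longleftrightarrow> (\<forall>n\<ge>1. \<forall>k. nabla n a k \<ge> 0)"

definition completely_alternating :: "(nat \<Rightarrow> real) \<Rightarrow> bool" where
  "completely_alternating a \<longleftrightarrow> (\<forall>n\<ge>1. \<forall>k. nabla n a k \<le> 0)"

definition log_completely_monotone :: "(nat \<Rightarrow> real) \<Rightarrow> bool" where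
  "log_completely_monotone a \<longleftrightarrow> (\<forall>j. a j > 0) \<and> completely_monotone (\<lambda>j. ln (a j))"

definition log_completely_alternating :: "(nat \<Rightarrow> real) \<Rightarrow> bool" where
  "log_completely_alternating a \<longleftrightarrow> (\<forall>j. a j > 0) \<and> completely_alternating (\<lambda>j. ln (a j))"

lemma weighted_shift_basis:
  "weighted_shift \<alpha> (l2_basis n) = (\<lambda>k. of_real (\<alpha> n) * l2_basis (Suc n) k)"
  by (auto simp: weighted_shift_def l2_basis_def fun_eq_iff split: nat.splits)

lemma l2_basis: "l2_basis n \<in> l2" "l2_norm (l2_basis n) = 1"
proof -
  have "(\<lambda>k. (cmod (l2_basis n k))\<^sup>2) = (\<lambda>k. if k = n then 1 else 0)"
    by (auto simp: l2_basis_def)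
  then have "(\<lambda>k. (cmod (l2_basis n k))\<^sup>2) sums 1"
    using sums_single[of n "\<lambda>_. 1 :: real"] by simp
  then show "l2_basis n \<in> l2" "l2_norm (l2_basis n) = 1"
    by (auto simp: l2_def l2_norm_def sums_iff)
qed

lemma weighted_shift_sum:
  assumes "\<And>n. \<bar>\<alpha> n\<bar> \<le> M" "x \<in> l2"
  shows "summable (\<lambda>n. (cmod (weighted_shift \<alpha> x n))\<^sup>2)"
    and "(\<Sum>n. (cmod (weighted_shift \<alpha> x n))\<^sup>2) \<le> M\<^sup>2 * (\<Sum>n. (cmod (x n))\<^sup>2)"
proof -
  let ?f = "\<lambda>n. (cmod (weighted_shift \<alpha> x n))\<^sup>2"
  have s: "summable (\<lambda>n. (cmod (x n))\<^sup>2)"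
    using assms(2) by (simp add: l2_def)
  have le: "?f (Suc n) \<le> M\<^sup>2 * (cmod (x n))\<^sup>2" for n
  proof -
    have "(\<alpha> n)\<^sup>2 \<le> M\<^sup>2"
      using assms(1)[of n] by (simp add: abs_le_square_iff[symmetric])
    then show ?thesis
      by (simp add: weighted_shift_def norm_mult power_mult_distrib mult_right_mono)
  qed
  have s1: "summable (\<lambda>n. ?f (Suc n))"
    by (rule summable_comparison_test'[OF summable_mult[OF s, of "M\<^sup>2"], of 0]) (use le in simp)
  then show *: "summable ?f"
    by (subst (asm) summable_Suc_iff)
  have "suminf ?f = (\<Sum>n. ?f (Suc n))"
    using suminf_split_head[OF *] by (simp add: weighted_shift_def)
  also have "\<dots> \<le> (\<Sum>n. M\<^sup>2 * (cmod (x n))\<^sup>2)"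
    by (rule suminf_le[OF le s1 summable_mult[OF s]])
  also have "\<dots> = M\<^sup>2 * (\<Sum>n. (cmod (x n))\<^sup>2)"
    by (rule suminf_mult[OF s])
  finally show "suminf ?f \<le> M\<^sup>2 * (\<Sum>n. (cmod (x n))\<^sup>2)" .
qed

lemma weighted_shift_l2:
  assumes "bounded (range \<alpha>)" "x \<in> l2"
  shows "weighted_shift \<alpha> x \<in> l2"
proof -
  obtain M where "\<bar>\<alpha> n\<bar> \<le> M" for n
    using assms(1) unfolding bounded_iff by auto
  then show ?thesis
    using weighted_shift_sum(1)[of \<alpha> M x] assms(2) by (simp add: l2_def)
qed

lemma weighted_shift_le:
  assumes "\<And>n. \<bar>\<alpha> n\<bar> \<le> M" "x \<in> l2"
  shows "l2_norm (weighted_shift \<alpha> x) \<le> M * l2_norm x"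
proof -
  have "M \<ge> 0"
    using assms(1)[of 0] by linarith
  then show ?thesis
    using real_sqrt_le_mono[OF weighted_shift_sum(2)[OF assms]]
    by (simp add: l2_norm_def real_sqrt_mult)
qed

lemma l2_opnorm_weighted_shift:
  assumes "bounded (range \<alpha>)" "\<And>n. \<alpha> n > 0"
  shows "l2_opnorm (weighted_shift \<alpha>) = (SUP n. \<alpha> n)"
proof (rule antisym)
  have bdd: "bdd_above (range \<alpha>)"
    by (rule bounded_imp_bdd_above[OF assms(1)])
  define S where "S = (SUP n. \<alpha> n)"
  have le: "\<bar>\<alpha> n\<bar> \<le> S" for n
    using cSUP_upper[OF _ bdd, of n] assms(2)[of n] by (simp add: S_def)
  have S: "S \<ge> 0"
    using le[of 0] by linarith
  have ub: "l2_norm (weighted_shift \<alpha> x) \<le> S" if "x \<in> {x \<in> l2. l2_norm x \<le> 1}" for x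
  proof -
    have "l2_norm (weighted_shift \<alpha> x) \<le> S * l2_norm x"
      using that by (intro weighted_shift_le le) simp
    also have "\<dots> \<le> S"
      using that S by (simp add: mult_left_le)
    finally show ?thesis .
  qed
  have ne: "{x \<in> l2. l2_norm x \<le> 1} \<noteq> {}"
    using l2_basis[of 0] by auto
  show "l2_opnorm (weighted_shift \<alpha>) \<le> (SUP n. \<alpha> n)"
    unfolding l2_opnorm_def S_def[symmetric] by (rule cSUP_least[OF ne ub])
  have bdd': "bdd_above ((\<lambda>x. l2_norm (weighted_shift \<alpha> x)) ` {x \<in> l2. l2_norm x \<le> 1})"
    by (rule bdd_aboveI2[OF ub])
  have "\<alpha> n \<le> l2_opnorm (weighted_shift \<alpha>)" for n
  proof -
    have "l2_norm (weighted_shift \<alpha> (l2_basis n)) = \<alpha> n * l2_norm (l2_basis (Suc n))"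
      using assms(2)[of n] l2_basis(1)[of "Suc n"]
      by (simp add: weighted_shift_basis l2_norm_def l2_def norm_mult power_mult_distrib
          suminf_mult real_sqrt_mult)
    then have "\<alpha> n = l2_norm (weighted_shift \<alpha> (l2_basis n))"
      by (simp add: l2_basis)
    also have "\<dots> \<le> l2_opnorm (weighted_shift \<alpha>)"
      unfolding l2_opnorm_def by (rule cSUP_upper[OF _ bdd']) (simp add: l2_basis)
    finally show ?thesis .
  qed
  then show "(SUP n. \<alpha> n) \<le> l2_opnorm (weighted_shift \<alpha>)"
    by (intro cSUP_least) auto
qed

end

theory Submission
  imports Defs
begin

text \<open>Since \<open>\<gamma>\<^sub>k\<^sub>+\<^sub>1 = \<alpha>\<^sub>k\<^sup>2 \<gamma>\<^sub>k\<close>, the sequence \<open>ln (\<alpha>\<^sub>k\<^sup>2)\<close> is minus the first difference of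
  \<open>ln \<gamma>\<^sub>k\<close>. Hence the difference of order \<open>n + 1\<close> of \<open>ln \<gamma>\<close> is minus the difference of order \<open>n\<close>
  of \<open>ln (\<alpha>\<^sup>2)\<close> (\<open>nabla_Suc_ln_moment\<close>). Under this correspondence the orders
  \<open>n \<ge> 2\<close> for the moments are exactly the orders \<open>n \<ge> 1\<close> for the squared weights. What remains is
  order 1 for the moments, which says that \<open>ln (\<alpha>\<^sub>k\<^sup>2) \<le> 0\<close>; this is supplied by contractivity,
  because the norm of the shift is the supremum of the weights (\<open>contractive_weights_le_1\<close>).
  Passing from \<open>\<alpha>\<^sup>2\<close> to \<open>\<alpha>\<close> merely halves the logarithms, hence all their differences.\<close>

lemma nabla_cmult: "nabla n (\<lambda>j. c * a j) k = c * nabla n a k"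
  by (simp add: nabla_def sum_distrib_left mult_ac)

lemma nabla_0: "nabla 0 a k = a k"
  by (simp add: nabla_def)

text \<open>By Pascal's rule, the binomial sums of \<open>nabla\<close> are iterated first differences.\<close>

lemma nabla_Suc: "nabla (Suc n) a k = nabla n (\<lambda>j. a j - a (Suc j)) k"
proof -
  let ?t = "\<lambda>i. (-1) ^ i * real (n choose i) * a (k + i)"
  let ?u = "\<lambda>i. (-1) ^ i * real (n choose i) * a (Suc (k + i))"
  have pascal: "(-1) ^ Suc i * real (Suc n choose Suc i) * a (k + Suc i) = ?t (Suc i) - ?u i" for i
    by (simp add: algebra_simps)
  have "nabla (Suc n) a k = a k + (\<Sum>i\<le>n. ?t (Suc i) - ?u i)"
    unfolding nabla_def sum.atMost_Suc_shift pascal by simp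
  also have "\<dots> = (a k + (\<Sum>i\<le>n. ?t (Suc i))) - (\<Sum>i\<le>n. ?u i)"
    by (simp add: sum_subtractf)
  also have "a k + (\<Sum>i\<le>n. ?t (Suc i)) = (\<Sum>i\<le>Suc n. ?t i)"
    unfolding sum.atMost_Suc_shift by simp
  also have "\<dots> = (\<Sum>i\<le>n. ?t i)"
    by simp
  also have "\<dots> - (\<Sum>i\<le>n. ?u i) = nabla n (\<lambda>j. a j - a (Suc j)) k"
    by (simp add: nabla_def right_diff_distrib sum_subtractf)
  finally show ?thesis .
qed

lemma moment_pos:
  assumes "\<And>n. \<alpha> n > 0"
  shows "moment \<alpha> n > 0"
  unfolding moment_def by (intro prod_pos ballI zero_less_power assms)

lemma nabla_Suc_ln_moment:
  assumes "\<And>n. \<alpha> n > 0"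
  shows "nabla (Suc n) (\<lambda>j. ln (moment \<alpha> j)) k = - nabla n (\<lambda>j. ln ((\<alpha> j)\<^sup>2)) k"
proof -
  have "moment \<alpha> (Suc j) = moment \<alpha> j * (\<alpha> j)\<^sup>2" for j
    by (simp add: moment_def)
  then have "ln (moment \<alpha> j) - ln (moment \<alpha> (Suc j)) = - 1 * ln ((\<alpha> j)\<^sup>2)" for j
    using ln_mult_pos[OF moment_pos[OF assms] zero_less_power[OF assms]] by simp
  then show ?thesis
    unfolding nabla_Suc using nabla_cmult[of n "- 1" "\<lambda>j. ln ((\<alpha> j)\<^sup>2)" k] by simp
qed

lemma contractive_weights_le_1:
  assumes "\<And>n. \<alpha> n > 0" "bounded (range \<alpha>)" "contractive (weighted_shift \<alpha>)"
  shows "\<alpha> n \<le> 1"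
proof -
  have "\<alpha> n \<le> (SUP n. \<alpha> n)"
    by (rule cSUP_upper[OF UNIV_I bounded_imp_bdd_above[OF assms(2)]])
  also have "\<dots> \<le> 1"
    using assms(3) l2_opnorm_weighted_shift[OF assms(2,1)] by (simp add: contractive_def)
  finally show ?thesis .
qed

lemma log_completely_alternating_power2_iff:
  assumes "\<And>n. \<alpha> n > 0"
  shows "log_completely_alternating (\<lambda>n. (\<alpha> n)\<^sup>2) \<longleftrightarrow> log_completely_alternating \<alpha>"
proof -
  have "(\<lambda>j. ln ((\<alpha> j)\<^sup>2)) = (\<lambda>j. 2 * ln (\<alpha> j))"
    using assms by (simp add: ln_realpow)
  then show ?thesis
    by (simp add: log_completely_alternating_def completely_alternating_def nabla_cmult
        mult_le_0_iff assms order_less_imp_not_eq2[OF assms])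
qed

lemma log_completely_monotone_moment_iff:
  assumes pos: "\<And>n. \<alpha> n > 0" and le_1: "\<And>n. \<alpha> n \<le> 1"
  shows "log_completely_alternating (\<lambda>n. (\<alpha> n)\<^sup>2) \<longleftrightarrow> log_completely_monotone (moment \<alpha>)"
proof -
  let ?l = "\<lambda>j. ln ((\<alpha> j)\<^sup>2)"
  have order_0: "nabla 0 ?l k \<le> 0" for k
    using pos[of k] le_1[of k] by (simp add: nabla_0 power_le_one)
  have "log_completely_monotone (moment \<alpha>) \<longleftrightarrow>
      (\<forall>n k. 0 \<le> nabla (Suc n) (\<lambda>j. ln (moment \<alpha> j)) k)"
    by (simp add: log_completely_monotone_def completely_monotone_def moment_pos[OF pos]
        Suc_le_eq gr0_conv_Suc) blast
  also have "\<dots> \<longleftrightarrow> (\<forall>n k. nabla n ?l k \<le> 0)"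
    by (simp only: nabla_Suc_ln_moment[OF pos] neg_0_le_iff_le)
  also have "\<dots> \<longleftrightarrow> (\<forall>n\<ge>1. \<forall>k. nabla n ?l k \<le> 0)"
    using order_0 by (metis One_nat_def Suc_leI neq0_conv)
  also have "\<dots> \<longleftrightarrow> log_completely_alternating (\<lambda>n. (\<alpha> n)\<^sup>2)"
    by (simp add: log_completely_alternating_def completely_alternating_def
        order_less_imp_not_eq2[OF pos])
  finally show ?thesis by blast
qed

theorem proposition3p3:
  fixes \<alpha> :: "nat \<Rightarrow> real"
  assumes pos: "\<And>n. \<alpha> n > 0"
    and bdd: "bounded (range \<alpha>)"
    and contr: "contractive (weighted_shift \<alpha>)"
  shows "(log_completely_alternating (\<lambda>n. (\<alpha> n)\<^sup>2) \<longleftrightarrow> log_completely_alternating \<alpha>) \<and>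
    (log_completely_alternating (\<lambda>n. (\<alpha> n)\<^sup>2) \<longleftrightarrow> log_completely_monotone (moment \<alpha>))"
  using log_completely_alternating_power2_iff[of \<alpha>, OF pos]
    log_completely_monotone_moment_iff[of \<alpha>, OF pos contractive_weights_le_1[OF pos bdd contr]]
  by blast

end
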